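(* Let $\gamma\in\mathbb{C}$ with $0<|\gamma|<1$. For every integer $n\ge N_\gamma$, the numbers $\psi(s_{\gamma,n,j})$ with $j\in\{1,\ldots,n\}$ are pairwise distinct eigenvalues of $A_{\gamma,n}$. Moreover, the real parts of the numbers $s_{\gamma,n,j}$ form a strictly increasing list contained in $(0,\pi)$: $$0<\operatorname{Re}(s_{\gamma,n,1})<\operatorname{Re}(s_{\gamma,n,2})<\cdots<\operatorname{Re}(s_{\gamma,n,n})<\pi.$$
   Context: $A_{\gamma,n}$ is the $n\times n$ matrix $T_n(a)+\gamma E_{n,1,1}$, where $T_n(a)$ is the tridiagonal Toeplitz matrix with entries $(T_n(a))_{j+1,j}=1$, $(T_n(a))_{j,j+1}=-1$ and all other entries $0$, and $E_{n,1,1}$ has entry $(1,1)$ equal to $1$ and all other entries $0$. $\psi(z)=2i\cos(z)$. $\Delta_\gamma=\ln\frac{1}{|\gamma|}$. For $|\operatorname{Im}(z)|<\Delta_\gamma$, $$\vartheta_\gamma(z)=-\frac{i}{2}\ln\left(\frac{1+i\gamma e^{iz}}{1+i\gamma e^{-iz}}\right),$$ where $\ln$ is the principal branch of the logarithm on $\mathbb{C}\setminus(-\infty,0]$ (the argument of the logarithm lies in this set for all such $z$). Definition of $s_{\gamma,n,j}$: put $d_{n,j}=\frac{j\pi}{n+1}$, $p_{\gamma,n,j}=d_{n,j}+\frac{\vartheta_\gamma(d_{n,j})}{n+1}$, $M_\gamma=\frac{64\sqrt{|\gamma|}}{(1-|\gamma|)^3}$, $N_\gamma=\frac{16}{(1-|\gamma|)^2}$,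 and $\mathcal{B}_{\gamma,n,j}=\{z\in\mathbb{C}\colon |z-p_{\gamma,n,j}|<M_\gamma/(n+1)^2\}$. For every integer $n\ge N_\gamma$ and $j\in\{1,\ldots,n\}$, $s_{\gamma,n,j}$ is the unique point of $\mathcal{B}_{\gamma,n,j}$ with $s_{\gamma,n,j}=\frac{j\pi}{n+1}+\frac{\vartheta_\gamma(s_{\gamma,n,j})}{n+1}$. *)

theory Defs
  imports "HOL-Analysis.Complex_Transcendental" "Jordan_Normal_Form.Char_Poly"
begin

(* Matrix positions are 0-based here: row i and column j stand for the entry (i + 1, j + 1). *)

definition T_mat :: "nat \<Rightarrow> complex mat" where
  "T_mat n = mat n n (\<lambda>(i, j). if i = j + 1 then 1 else if j = i + 1 then -1 else 0)"

definition E11_mat :: "nat \<Rightarrow> complex mat" where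
  "E11_mat n = mat n n (\<lambda>(i, j). if i = 0 \<and> j = 0 then 1 else 0)"

definition A_mat :: "complex \<Rightarrow> nat \<Rightarrow> complex mat" where
  "A_mat \<gamma> n = T_mat n + \<gamma> \<cdot>\<^sub>m E11_mat n"

definition \<psi> :: "complex \<Rightarrow> complex" where
  "\<psi> z = 2 * \<i> * cos z"

(* Meaningful for \<bar>Im z\<bar> < ln (1 / cmod \<gamma>), where the argument of the principal
   logarithm Ln avoids the closed negative real axis; outside this strip the value is arbitrary. *)
definition \<theta> :: "complex \<Rightarrow> complex \<Rightarrow> complex" where
  "\<theta> \<gamma> z = - (\<i> / 2) * Ln ((1 + \<i> * \<gamma> * exp (\<i> * z)) / (1 + \<i> * \<gamma> * exp (- \<i> * z)))"

definition d_pt :: "nat \<Rightarrow> nat \<Rightarrow> real" where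
  "d_pt n j = real j * pi / (real n + 1)"

definition p_pt :: "complex \<Rightarrow> nat \<Rightarrow> nat \<Rightarrow> complex" where
  "p_pt \<gamma> n j = of_real (d_pt n j) + \<theta> \<gamma> (of_real (d_pt n j)) / (of_nat n + 1)"

definition M_bound :: "complex \<Rightarrow> real" where
  "M_bound \<gamma> = 64 * sqrt (cmod \<gamma>) / (1 - cmod \<gamma>) ^ 3"

definition N_bound :: "complex \<Rightarrow> real" where
  "N_bound \<gamma> = 16 / (1 - cmod \<gamma>) ^ 2"

definition B_disk :: "complex \<Rightarrow> nat \<Rightarrow> nat \<Rightarrow> complex set" where
  "B_disk \<gamma> n j = {z. cmod (z - p_pt \<gamma> n j) < M_bound \<gamma> / (real n + 1) ^ 2}"

(* For 0 < cmod \<gamma> < 1, N_bound \<gamma> \<le> n and 1 \<le> j \<le> n such a point exists and is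
   unique, and the disk lies inside the strip \<bar>Im z\<bar> < ln (1 / cmod \<gamma>).
   Otherwise the value carries no meaning. *)
definition s_pt :: "complex \<Rightarrow> nat \<Rightarrow> nat \<Rightarrow> complex" where
  "s_pt \<gamma> n j = (THE z. z \<in> B_disk \<gamma> n j \<and>
     z = of_real (d_pt n j) + \<theta> \<gamma> z / (of_nat n + 1))"

end

theory Submission imports Defs begin

text \<open>
  Write \<open>N = n + 1\<close> and \<open>g = cmod \<gamma>\<close>. The points \<open>s_pt \<gamma> n j\<close> are fixed points of the maps
  \<open>z \<mapsto> j * pi / N + \<theta> \<gamma> z / N\<close>, and everything follows from one estimate on them: on the closed
  strip \<open>\<bar>Im z\<bar> \<le> ln (1 / g) / 2\<close> the function \<open>\<theta> \<gamma>\<close> is Lipschitz with constant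
  \<open>2 * sqrt g / (1 - g)\<close> (\<open>theta_lipschitz\<close>). Since \<open>N \<ge> 16 / (1 - g)\<^sup>2\<close>, each of the maps contracts
  distances in the strip by a factor at most \<open>1 / 8\<close> (\<open>F_contraction\<close>).

  Existence and uniqueness: \<open>\<theta> \<gamma>\<close> vanishes at \<open>0\<close> and at \<open>pi\<close>, so the Lipschitz bound makes it
  small on the whole segment between them. Hence the centre \<open>p_pt \<gamma> n j\<close>, which is the image of
  \<open>d_pt n j\<close>, is close to \<open>d_pt n j\<close>; the closed disc around it lies in the strip and is mapped into
  its interior, and Banach's theorem gives a unique fixed point.

  Order: if \<open>z\<close> and \<open>w\<close> are fixed points for the indices \<open>k > j\<close>, then \<open>z - w\<close> differs from the
  positive number \<open>(k - j) * pi / N\<close> by at most \<open>cmod (z - w) / 8\<close>, so its real part is positive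
  (\<open>Re_fixed_point_less\<close>). Because \<open>0\<close> and \<open>pi\<close> are themselves the fixed points for the indices \<open>0\<close>
  and \<open>N\<close>, the same comparison confines the real parts to the interval from \<open>0\<close> to \<open>pi\<close>. There the
  cosine is injective, which makes the values of \<open>\<psi>\<close> distinct.

  Eigenvalues: the vector with entries \<open>(- \<i>) ^ k * sin ((n - k) * z)\<close> satisfies every row of the
  eigenvalue equation for \<open>\<psi> z\<close> except possibly the first, which requires
  \<open>\<gamma> * sin (n * z) = \<i> * sin (N * z)\<close>. Exponentiating \<open>N * z = j * pi + \<theta> \<gamma> z\<close> yields exactly this
  condition (\<open>sine_condition\<close>).
\<close>

(* Otherwise $ would be ambiguous with indexing in finite Cartesian products. *)
unbundle no vec_syntax

section \<open>The strip and elementary estimates\<close>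

text \<open>
  Half as wide as the strip where \<open>\<theta> \<gamma>\<close> is analytic. On it \<open>cmod (\<gamma> * exp (\<plusminus> \<i> * z))\<close> is at most
  \<open>sqrt (cmod \<gamma>)\<close>, hence bounded away from \<open>1\<close>, while points of the real axis still have room around
  them of order \<open>1 - cmod \<gamma>\<close>.
\<close>

definition inner_strip :: "complex \<Rightarrow> complex set" where
  "inner_strip \<gamma> = {z. \<bar>Im z\<bar> \<le> - ln (cmod \<gamma>) / 2}"

lemma convex_inner_strip: "convex (inner_strip \<gamma>)"
proof -
  have "inner_strip \<gamma> = {z. Im z \<le> - ln (cmod \<gamma>) / 2} \<inter> {z. Im z \<ge> - (- ln (cmod \<gamma>) / 2)}"
    by (auto simp: inner_strip_def)
  then show ?thesis
    by (simp only: convex_Int convex_halfspace_Im_le convex_halfspace_Im_ge)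
qed

lemma uminus_inner_strip: "z \<in> inner_strip \<gamma> \<Longrightarrow> - z \<in> inner_strip \<gamma>"
  by (simp add: inner_strip_def)

lemma of_real_inner_strip:
  assumes "cmod \<gamma> < 1"
  shows "of_real x \<in> inner_strip \<gamma>"
proof -
  have "ln (cmod \<gamma>) \<le> 0"
    using assms ln_le_minus_one[of "cmod \<gamma>"] by (cases "\<gamma> = 0") auto
  then show ?thesis unfolding inner_strip_def mem_Collect_eq Im_complex_of_real by linarith
qed

lemma cmod_exp_inner_strip:
  assumes "0 < cmod \<gamma>" and "z \<in> inner_strip \<gamma>"
  shows "cmod (\<gamma> * exp (\<i> * z)) \<le> sqrt (cmod \<gamma>)"
proof -
  have "cmod (\<gamma> * exp (\<i> * z)) = exp (ln (cmod \<gamma>)) * exp (- Im z)"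
    using assms by (simp add: norm_mult)
  also have "\<dots> = exp (ln (cmod \<gamma>) - Im z)"
    by (simp add: exp_diff exp_minus divide_inverse)
  also have "\<dots> \<le> exp (ln (cmod \<gamma>) / 2)"
    using assms(2) by (simp add: inner_strip_def abs_le_iff)
  also have "\<dots> = sqrt (cmod \<gamma>)"
    using assms(1) by (simp flip: ln_sqrt)
  finally show ?thesis .
qed

text \<open>
  The right-hand side replaces \<open>1 - sqrt g\<close> by \<open>1 - g\<close>, in powers of which the radius of the discs and
  the lower bound on \<open>n\<close> are given; the factor \<open>2\<close> bounds \<open>1 + sqrt g\<close>.
\<close>

lemma sqrt_fraction_le:
  fixes g :: real
  assumes "0 \<le> g" "g < 1"
  shows "sqrt g / (1 - sqrt g) \<le> 2 * sqrt g / (1 - g)"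
proof -
  have s: "0 \<le> sqrt g" "sqrt g < 1" using assms by auto
  have "1 - g = (1 - sqrt g) * (1 + sqrt g)"
    using assms by (simp add: algebra_simps)
  also have "\<dots> \<le> (1 - sqrt g) * 2"
    using s by (intro mult_left_mono) auto
  finally have "(1 - g) / 2 \<le> 1 - sqrt g" by simp
  then have "sqrt g / (1 - sqrt g) \<le> sqrt g / ((1 - g) / 2)"
    using s assms by (intro divide_left_mono mult_pos_pos) auto
  then show ?thesis by (simp add: mult.commute)
qed

lemma cmod_div_one_plus_le:
  fixes a :: complex
  assumes "cmod a \<le> q" "q < 1"
  shows "cmod (a / (1 + \<i> * a)) \<le> q / (1 - q)"
proof -
  have "1 - q \<le> 1 - cmod (\<i> * a)" using assms by (simp add: norm_mult)
  also have "\<dots> \<le> cmod (1 + \<i> * a)"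
    using norm_diff_ineq[of 1 "\<i> * a"] by simp
  finally have "1 - q \<le> cmod (1 + \<i> * a)" .
  then show ?thesis
    unfolding norm_divide using assms norm_ge_zero[of a]
    by (intro frac_le) linarith+
qed

lemma Re_one_plus_pos: "cmod a < 1 \<Longrightarrow> 0 < Re (1 + \<i> * a)"
  using abs_Im_le_cmod[of a] by simp

text \<open>
  Both arguments lie strictly between \<open>- pi / 2\<close> and \<open>pi / 2\<close>, so their difference stays within the range
  of the principal branch.
\<close>

lemma Ln_divide_right_half_plane:
  assumes "0 < Re u" "0 < Re v"
  shows "Ln (u / v) = Ln u - Ln v"
proof -
  have nz: "u \<noteq> 0" "v \<noteq> 0" using assms by auto
  have "\<bar>Im (Ln u)\<bar> < pi / 2" "\<bar>Im (Ln v)\<bar> < pi / 2"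
    using assms nz Re_Ln_pos_lt by blast+
  then have "Ln (exp (Ln u - Ln v)) = Ln u - Ln v"
    by (intro Ln_exp) (auto simp: abs_less_iff)
  then show ?thesis using nz by (simp add: exp_diff)
qed

section \<open>The phase function\<close>

locale gamma_disc =
  fixes \<gamma> :: complex
  assumes pos: "0 < cmod \<gamma>" and less1: "cmod \<gamma> < 1"
begin

abbreviation "g \<equiv> cmod \<gamma>"

lemma cmod_exp_less_1:
  assumes "z \<in> inner_strip \<gamma>"
  shows "cmod (\<gamma> * exp (\<i> * z)) < 1"
proof -
  have "sqrt g < 1" using less1 by simp
  with cmod_exp_inner_strip[OF pos assms] show ?thesis by linarith
qed

lemma Re_factor_pos:
  assumes "z \<in> inner_strip \<gamma>"
  shows "0 < Re (1 + \<i> * \<gamma> * exp (\<i> * z))" "0 < Re (1 + \<i> * \<gamma> * exp (- \<i> * z))"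
  using Re_one_plus_pos[OF cmod_exp_less_1[OF assms]]
    Re_one_plus_pos[OF cmod_exp_less_1[OF uminus_inner_strip[OF assms]]]
  by (simp_all add: mult.assoc)

lemma theta_eq:
  assumes "z \<in> inner_strip \<gamma>"
  shows "\<theta> \<gamma> z = - (\<i> / 2) * (Ln (1 + \<i> * \<gamma> * exp (\<i> * z)) - Ln (1 + \<i> * \<gamma> * exp (- \<i> * z)))"
  unfolding \<theta>_def using Ln_divide_right_half_plane[OF Re_factor_pos[OF assms]] by simp

text \<open>
  With \<open>h z = \<gamma> * exp (\<i> * z) / (1 + \<i> * \<gamma> * exp (\<i> * z))\<close>, the derivative of \<open>\<theta> \<gamma>\<close> is
  \<open>\<i> / 2 * (h z + h (- z))\<close>. Both summands are bounded by the claimed constant and the strip is convex.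
\<close>

lemma theta_lipschitz:
  assumes "w \<in> inner_strip \<gamma>" "z \<in> inner_strip \<gamma>"
  shows "cmod (\<theta> \<gamma> w - \<theta> \<gamma> z) \<le> 2 * sqrt g / (1 - g) * cmod (w - z)"
proof (rule field_differentiable_bound[OF convex_inner_strip _ _ assms(1,2)])
  let ?h = "\<lambda>z. \<gamma> * exp (\<i> * z) / (1 + \<i> * (\<gamma> * exp (\<i> * z)))"
  let ?D = "\<lambda>z. \<i> / 2 * (?h z + ?h (- z))"
  fix z assume z: "z \<in> inner_strip \<gamma>"
  have not_neg: "1 + \<i> * \<gamma> * exp (\<i> * z) \<notin> \<real>\<^sub>\<le>\<^sub>0" "1 + \<i> * \<gamma> * exp (- \<i> * z) \<notin> \<real>\<^sub>\<le>\<^sub>0"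
    using Re_factor_pos[OF z] by (auto simp: complex_nonpos_Reals_iff)
  have "((\<lambda>z. - (\<i> / 2) * (Ln (1 + \<i> * \<gamma> * exp (\<i> * z)) - Ln (1 + \<i> * \<gamma> * exp (- \<i> * z))))
      has_field_derivative ?D z) (at z within inner_strip \<gamma>)"
  proof -
    have "((\<lambda>z. Ln (1 + \<i> * \<gamma> * exp (\<i> * z))) has_field_derivative - ?h z) (at z within inner_strip \<gamma>)"
      using not_neg(1) by (auto intro!: derivative_eq_intros simp: divide_inverse mult_ac)
    moreover have "((\<lambda>z. Ln (1 + \<i> * \<gamma> * exp (- \<i> * z))) has_field_derivative ?h (- z)) (at z within inner_strip \<gamma>)"
      using not_neg(2) by (auto intro!: derivative_eq_intros simp: divide_inverse mult_ac)
    ultimately have "((\<lambda>z. - (\<i> / 2) * (Ln (1 + \<i> * \<gamma> * exp (\<i> * z)) - Ln (1 + \<i> * \<gamma> * exp (- \<i> * z))))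
        has_field_derivative - (\<i> / 2) * (- ?h z - ?h (- z))) (at z within inner_strip \<gamma>)"
      by (intro DERIV_cmult DERIV_diff)
    moreover have "- (\<i> / 2) * (- ?h z - ?h (- z)) = ?D z" by (simp add: algebra_simps)
    ultimately show ?thesis by (rule DERIV_cong)
  qed
  then show "(\<theta> \<gamma> has_field_derivative ?D z) (at z within inner_strip \<gamma>)"
    by (rule has_field_derivative_transform_within[where d = 1]) (use z in \<open>simp_all add: theta_eq\<close>)
  have h: "cmod (?h y) \<le> 2 * sqrt g / (1 - g)" if "y \<in> inner_strip \<gamma>" for y
    using cmod_div_one_plus_le[OF cmod_exp_inner_strip[OF pos that]]
      sqrt_fraction_le[of g] less1 by fastforce
  have "cmod (?D z) = cmod (?h z + ?h (- z)) / 2" by (simp add: norm_mult)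
  also have "\<dots> \<le> (cmod (?h z) + cmod (?h (- z))) / 2"
    by (intro divide_right_mono norm_triangle_ineq) simp
  also have "\<dots> \<le> 2 * sqrt g / (1 - g)"
    using h[OF z] h[OF uminus_inner_strip[OF z]] by argo
  finally show "cmod (?D z) \<le> 2 * sqrt g / (1 - g)" .
qed

lemma theta_0: "\<theta> \<gamma> 0 = 0"
  using theta_eq[of 0] of_real_inner_strip[OF less1, of 0] by simp

lemma theta_pi: "\<theta> \<gamma> (of_real pi) = 0"
proof -
  have "exp (\<i> * of_real pi) = -1" "exp (- \<i> * of_real pi) = -1"
    by (simp_all add: exp_minus)
  then show ?thesis
    using theta_eq[OF of_real_inner_strip[OF less1, of pi]] by simp
qed

text \<open>
  Compare with whichever of the zeros \<open>0\<close> and \<open>pi\<close> of \<open>\<theta> \<gamma>\<close> is at distance at most \<open>2\<close> from \<open>x\<close>; one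
  of them is because \<open>pi < 4\<close>.
\<close>

lemma theta_real_bound:
  assumes "0 \<le> x" "x \<le> pi"
  shows "cmod (\<theta> \<gamma> (of_real x)) \<le> 4 * sqrt g / (1 - g)"
proof -
  define L where "L = 2 * sqrt g / (1 - g)"
  have L: "0 \<le> L" using less1 by (simp add: L_def)
  have lip: "cmod (\<theta> \<gamma> (of_real x) - \<theta> \<gamma> (of_real y)) \<le> L * \<bar>x - y\<bar>" for y
    using theta_lipschitz[OF of_real_inner_strip of_real_inner_strip, OF less1 less1, of x y]
    by (simp add: L_def flip: of_real_diff)
  have "cmod (\<theta> \<gamma> (of_real x)) \<le> L * 2"
  proof (cases "x \<le> 2")
    case True
    have "cmod (\<theta> \<gamma> (of_real x)) \<le> L * \<bar>x - 0\<bar>" using lip[of 0] by (simp add: theta_0)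
    also have "\<dots> \<le> L * 2" using assms True L by (intro mult_left_mono) auto
    finally show ?thesis .
  next
    case False
    have "cmod (\<theta> \<gamma> (of_real x)) \<le> L * \<bar>x - pi\<bar>" using lip[of pi] by (simp add: theta_pi)
    also have "\<dots> \<le> L * 2" using assms False L pi_less_4 by (intro mult_left_mono) auto
    finally show ?thesis .
  qed
  then show ?thesis by (simp add: L_def)
qed

lemma exp_theta:
  assumes "z \<in> inner_strip \<gamma>"
  shows "exp (2 * \<i> * \<theta> \<gamma> z) * (1 + \<i> * \<gamma> * exp (- \<i> * z)) = 1 + \<i> * \<gamma> * exp (\<i> * z)"
proof -
  have nz: "1 + \<i> * \<gamma> * exp (\<i> * z) \<noteq> 0" "1 + \<i> * \<gamma> * exp (- \<i> * z) \<noteq> 0"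
    using Re_factor_pos[OF assms] by (metis less_irrefl zero_complex.sel(1))+
  have "2 * \<i> * \<theta> \<gamma> z = Ln ((1 + \<i> * \<gamma> * exp (\<i> * z)) / (1 + \<i> * \<gamma> * exp (- \<i> * z)))"
    by (simp add: \<theta>_def)
  then have "exp (2 * \<i> * \<theta> \<gamma> z) = (1 + \<i> * \<gamma> * exp (\<i> * z)) / (1 + \<i> * \<gamma> * exp (- \<i> * z))"
    using nz by (simp only: exp_Ln divide_eq_0_iff) simp
  then show ?thesis using nz by simp
qed

end

section \<open>Eigenvectors of the perturbed Toeplitz matrix\<close>

text \<open>
  The hypothesis is the exponential of \<open>2 * \<i>\<close> times the fixed point equation. Multiplying by
  \<open>exp (- \<i> * (n + 1) * z)\<close> gives an equation whose two sides are exchanged by \<open>z \<mapsto> - z\<close>, and collecting the exponentials with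
  opposite exponents gives sines.
\<close>

lemma sine_condition:
  assumes "exp (2 * \<i> * ((of_nat n + 1) * z)) * (1 + \<i> * \<gamma> * exp (- \<i> * z)) = 1 + \<i> * \<gamma> * exp (\<i> * z)"
  shows "\<gamma> * sin (of_nat n * z) = \<i> * sin ((of_nat n + 1) * z)"
proof -
  let ?N = "of_nat n + 1 :: complex"
  \<comment> \<open>Here \<open>a\<close>, \<open>c\<close> are \<open>exp (\<plusminus> \<i> * N * z)\<close> and \<open>b\<close>, \<open>d\<close> are \<open>exp (\<plusminus> \<i> * n * z)\<close>; abstracting
     them leaves a purely polynomial identity.\<close>
  have combine: "a - c = x * (d - b)"
    if "c * (t * (1 + x * p)) = c * (1 + x * q)" "c * t = a" "a * p = b" "c * q = d"
    for a b c d t x p q :: complex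
  proof -
    have "a + x * b = c * (t * (1 + x * p))"
      by (simp add: that(2,3)[symmetric] algebra_simps)
    also have "\<dots> = c + x * d"
      unfolding that(1) by (simp add: that(4)[symmetric] algebra_simps)
    finally have "a = c + x * d - x * b" by (simp add: eq_diff_eq)
    then show ?thesis by (simp add: right_diff_distrib)
  qed
  have diff: "exp (\<i> * (?N * z)) - exp (- (\<i> * (?N * z)))
      = \<i> * \<gamma> * (exp (- (\<i> * (of_nat n * z))) - exp (\<i> * (of_nat n * z)))"
  proof (rule combine)
    show "exp (- (\<i> * (?N * z))) * (exp (2 * \<i> * (?N * z)) * (1 + \<i> * \<gamma> * exp (- \<i> * z)))
        = exp (- (\<i> * (?N * z))) * (1 + \<i> * \<gamma> * exp (\<i> * z))"
      by (simp only: assms)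
  qed (unfold exp_add[symmetric], auto intro!: arg_cong[where f = exp] simp: algebra_simps)
  show ?thesis
    unfolding sin_exp_eq diff by (simp add: field_simps)
qed

lemma sin_three_term:
  fixes x y :: complex
  shows "sin (x + y) + sin (x - y) = 2 * cos y * sin x"
  by (simp add: sin_add sin_diff)

text \<open>
  The function \<open>w\<close> is defined on all indices, so that \<open>w n = 0\<close> lets the last row follow the same
  formula as the inner rows.
\<close>

lemma A_mat_mult_vec:
  assumes "i < n" and "w n = 0"
  shows "(A_mat \<gamma> n *\<^sub>v vec n w) $ i = (if i = 0 then \<gamma> * w 0 else w (i - 1)) - w (i + 1)"
proof -
  have "(A_mat \<gamma> n *\<^sub>v vec n w) $ i = (\<Sum>k<n. A_mat \<gamma> n $$ (i, k) * w k)"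
    using assms(1)
    by (simp add: A_mat_def T_mat_def E11_mat_def scalar_prod_def atLeast0LessThan)
  also have "\<dots> = (\<Sum>k<n. (if i = k + 1 then w k else 0) - (if k = i + 1 then w k else 0)
      + (if k = 0 then if i = 0 then \<gamma> * w k else 0 else 0))"
    using assms(1) by (intro sum.cong) (auto simp: A_mat_def T_mat_def E11_mat_def)
  also have "\<dots> = (\<Sum>k<n. if i = k + 1 then w k else 0) - (\<Sum>k<n. if k = i + 1 then w k else 0)
      + (\<Sum>k<n. if k = 0 then if i = 0 then \<gamma> * w k else 0 else 0)"
    by (simp add: sum.distrib sum_subtractf)
  also have "(\<Sum>k<n. if i = k + 1 then w k else 0) = (if i = 0 then 0 else w (i - 1))"
    using assms(1) by (cases i) (auto simp: sum.delta')
  also have "(\<Sum>k<n. if k = i + 1 then w k else 0) = w (i + 1)"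
    using assms by (cases "i + 1 = n") (auto simp: sum.delta)
  also have "(\<Sum>k<n. if k = 0 then if i = 0 then \<gamma> * w k else 0 else 0) = (if i = 0 then \<gamma> * w 0 else 0)"
    using assms(1) by (simp add: sum.delta)
  finally show ?thesis by simp
qed

text \<open>
  The solutions \<open>x\<close> of \<open>1 / x - x = \<psi> z\<close> are \<open>- \<i> * exp (\<plusminus> \<i> * z)\<close>, and their powers solve the
  three-term recurrence of the inner rows. The combination
  \<open>(- \<i>) ^ k * sin ((n - k) * z)\<close> vanishes at \<open>k = n\<close>, as the last row demands; the first row is the
  hypothesis relating the two sines. The vector is nonzero because its last entry is a nonzero multiple of
  \<open>sin z\<close>.
\<close>

lemma eigenvalue_A_mat:
  assumes n: "0 < n" and sin: "sin z \<noteq> 0"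
    and bc: "\<gamma> * sin (of_nat n * z) = \<i> * sin ((of_nat n + 1) * z)"
  shows "eigenvalue (A_mat \<gamma> n) (\<psi> z)"
proof -
  define u where "u k = sin ((of_nat n - of_nat k) * z)" for k
  define w where "w k = (- \<i>) ^ k * u k" for k
  define v where "v = vec n w"
  have A: "A_mat \<gamma> n \<in> carrier_mat n n" by (simp add: A_mat_def T_mat_def E11_mat_def)
  have rec: "u k + u (Suc (Suc k)) = 2 * cos z * u (Suc k)" for k
    using sin_three_term[of "(of_nat n - of_nat (Suc k)) * z" z] by (simp add: u_def algebra_simps)
  have rec0: "sin ((of_nat n + 1) * z) + u 1 = 2 * cos z * u 0"
    using sin_three_term[of "of_nat n * z" z] by (simp add: u_def algebra_simps)
  have un: "u n = 0" by (simp add: u_def)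
  have "A_mat \<gamma> n *\<^sub>v v = \<psi> z \<cdot>\<^sub>v v"
  proof (rule eq_vecI)
    fix i assume "i < dim_vec (\<psi> z \<cdot>\<^sub>v v)"
    then have i: "i < n" by (simp add: v_def)
    have wn: "w n = 0" by (simp add: w_def un)
    have "(if i = 0 then \<gamma> * w 0 else w (i - 1)) - w (i + 1) = \<psi> z * w i"
    proof (cases i)
      case 0
      have "\<gamma> * w 0 - w 1 = \<i> * (sin ((of_nat n + 1) * z) + u 1)"
        using bc by (simp add: w_def u_def algebra_simps)
      then show ?thesis unfolding rec0 using 0 by (simp add: \<psi>_def w_def)
    next
      case (Suc k)
      have "w k - w (Suc (Suc k)) = (- \<i>) ^ k * (u k + u (Suc (Suc k)))"
        by (simp add: w_def algebra_simps)
      then show ?thesis using Suc by (simp add: rec \<psi>_def w_def)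
    qed
    then show "(A_mat \<gamma> n *\<^sub>v v) $ i = (\<psi> z \<cdot>\<^sub>v v) $ i"
      using A_mat_mult_vec[OF i, of w] wn i by (simp add: v_def)
  qed (simp add: v_def A_mat_def T_mat_def E11_mat_def)
  moreover have "v $ (n - 1) \<noteq> 0"
    using n sin by (simp add: v_def w_def u_def of_nat_diff)
  then have "v \<noteq> 0\<^sub>v n" using n by auto
  ultimately have "eigenvector (A_mat \<gamma> n) v (\<psi> z)"
    using A by (auto simp: eigenvector_def v_def)
  then show ?thesis by (auto simp: eigenvalue_def)
qed

section \<open>Cosine and sine on a vertical strip\<close>

lemma cos_eq_on_strip:
  assumes "cos w = cos z" "0 < Re w" "Re w < pi" "0 < Re z" "Re z < pi"
  shows "w = z"
proof -
  obtain m where m: "m \<in> \<int>" "w = z + of_real (2 * m * pi) \<or> w = - z + of_real (2 * m * pi)"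
    using assms(1) unfolding complex_cos_eq by blast
  then obtain k :: int where k: "m = of_int k" by (auto elim: Ints_cases)
  show ?thesis
    using m(2)
  proof
    assume w: "w = z + of_real (2 * m * pi)"
    then have "Re w - Re z = 2 * of_int k * pi" by (simp add: k)
    then have "\<bar>2 * of_int k * pi\<bar> < 1 * pi" using assms by argo
    then have "\<bar>2 * of_int k :: real\<bar> < 1" by (simp add: abs_mult)
    then have "k = 0" by linarith
    then show ?thesis using w k by simp
  next
    assume w: "w = - z + of_real (2 * m * pi)"
    then have "Re w + Re z = 2 * of_int k * pi" by (simp add: k)
    then have "0 < 2 * of_int k * pi" "2 * of_int k * pi < 2 * pi" using assms by argo+
    then have "0 < k" "k < 1" by (auto simp: zero_less_mult_iff)
    then show ?thesis by simp
  qed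
qed

lemma sin_nonzero_on_strip:
  assumes "0 < Re z" "Re z < pi"
  shows "sin z \<noteq> 0"
proof
  assume "sin z = 0"
  then obtain k :: int where "z = of_real (of_int k * pi)" by (auto simp: sin_eq_0)
  then have "0 < of_int k * pi" "of_int k * pi < 1 * pi" using assms by simp_all
  then have "0 < k" "k < 1" by (auto simp: zero_less_mult_iff)
  then show False by simp
qed

section \<open>The fixed points\<close>

locale gamma_size = gamma_disc +
  fixes n :: nat
  assumes large: "N_bound \<gamma> \<le> real n"
begin

abbreviation "N \<equiv> real n + 1"
abbreviation "r \<equiv> 1 - g"
abbreviation "R \<equiv> M_bound \<gamma> / N\<^sup>2"

definition F :: "nat \<Rightarrow> complex \<Rightarrow> complex" where
  "F j z = of_real (d_pt n j) + \<theta> \<gamma> z / (of_nat n + 1)"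

lemma cmod_N: "cmod (of_nat n + 1) = N"
  by (metis add.commute norm_of_nat of_nat_Suc)

lemma inverse_N_le: "1 / N \<le> r\<^sup>2 / 16"
proof -
  have "0 < 16 / r\<^sup>2" using less1 by simp
  moreover have "16 / r\<^sup>2 \<le> N" using large by (simp add: N_bound_def)
  ultimately have "1 / N \<le> 1 / (16 / r\<^sup>2)" by (intro divide_left_mono) auto
  then show ?thesis by simp
qed

lemma contraction_factor_le: "2 * sqrt g / (r * N) \<le> 1 / 8"
proof -
  have "sqrt g \<le> 1" using less1 by simp
  then have c: "sqrt g * r \<le> 1" using less1 by (intro mult_le_one) auto
  have "2 * sqrt g / (r * N) = 2 * sqrt g / r * (1 / N)" by simp
  also have "\<dots> \<le> 2 * sqrt g / r * (r\<^sup>2 / 16)"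
    using inverse_N_le less1 by (intro mult_left_mono) auto
  also have "\<dots> = sqrt g * r / 8"
    using less1 by (simp add: power2_eq_square)
  finally show ?thesis using c by simp
qed

text \<open>
  The real shift is subtracted so that one estimate covers both a single map (\<open>j = k\<close>), for the
  contraction principle, and the comparison of fixed points of different maps. The factor \<open>1 / N\<close> is
  kept explicit because the radius \<open>R\<close> of the discs is of order \<open>1 / N\<^sup>2\<close>.
\<close>

lemma F_lipschitz:
  assumes "w \<in> inner_strip \<gamma>" "z \<in> inner_strip \<gamma>"
  shows "cmod (F j w - F k z - of_real (d_pt n j - d_pt n k)) \<le> 2 * sqrt g / (r * N) * cmod (w - z)"
proof -
  have "F j w - F k z - of_real (d_pt n j - d_pt n k) = (\<theta> \<gamma> w - \<theta> \<gamma> z) / (of_nat n + 1)"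
    by (simp add: F_def diff_divide_distrib)
  then have "cmod (F j w - F k z - of_real (d_pt n j - d_pt n k)) = cmod (\<theta> \<gamma> w - \<theta> \<gamma> z) / N"
    by (simp add: norm_divide cmod_N)
  also have "\<dots> \<le> (2 * sqrt g / r * cmod (w - z)) / N"
    using theta_lipschitz[OF assms] by (intro divide_right_mono) auto
  finally show ?thesis by simp
qed

lemma F_contraction:
  assumes "w \<in> inner_strip \<gamma>" "z \<in> inner_strip \<gamma>"
  shows "cmod (F j w - F k z - of_real (d_pt n j - d_pt n k)) \<le> cmod (w - z) / 8"
  using F_lipschitz[OF assms, of j k]
    mult_right_mono[OF contraction_factor_le, of "cmod (w - z)"] by simp

lemma d_pt_range: "j \<le> n + 1 \<Longrightarrow> 0 \<le> d_pt n j \<and> d_pt n j \<le> pi"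
  using mult_right_mono[of "real j" N pi] by (auto simp: d_pt_def pos_divide_le_eq mult.commute)

lemma R_pos: "0 < R"
  using pos less1 by (simp add: M_bound_def)

lemma R_le: "R \<le> sqrt g * r / 4"
proof -
  have "R = 64 * sqrt g / r ^ 3 * (1 / N)\<^sup>2" by (simp add: M_bound_def power_divide)
  also have "\<dots> \<le> 64 * sqrt g / r ^ 3 * (r\<^sup>2 / 16)\<^sup>2"
    using inverse_N_le less1 by (intro mult_left_mono power_mono) auto
  also have "\<dots> = sqrt g * r / 4"
  proof -
    have "64 * c / x ^ 3 * (x\<^sup>2 / 16)\<^sup>2 = c * x / 4" if "0 < x" for c x :: real
      using that by (simp add: field_simps eval_nat_numeral)
    from this[of r] show ?thesis using less1 by simp
  qed
  finally show ?thesis .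
qed

lemma cmod_p_pt_minus_d_pt:
  assumes "j \<le> n + 1"
  shows "cmod (p_pt \<gamma> n j - of_real (d_pt n j)) \<le> 4 * sqrt g / r / N"
proof -
  have "cmod (p_pt \<gamma> n j - of_real (d_pt n j)) = cmod (\<theta> \<gamma> (of_real (d_pt n j))) / N"
    by (simp add: p_pt_def norm_divide cmod_N)
  also have "\<dots> \<le> 4 * sqrt g / r / N"
    using theta_real_bound d_pt_range[OF assms] by (intro divide_right_mono) auto
  finally show ?thesis .
qed

text \<open>
  The distance of \<open>z\<close> from the real point \<open>d_pt n j\<close> is at most the radius plus the distance
  between \<open>p_pt \<gamma> n j\<close> and \<open>d_pt n j\<close>. Each of the two is at most \<open>sqrt g * r / 4\<close>, and
  \<open>r / 2 \<le> - ln g / 2\<close>.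
\<close>

lemma disc_subset_strip:
  assumes "j \<le> n + 1" "z \<in> cball (p_pt \<gamma> n j) R"
  shows "z \<in> inner_strip \<gamma>"
proof -
  have s: "sqrt g \<le> 1" using less1 by simp
  have "\<bar>Im z\<bar> = \<bar>Im (z - of_real (d_pt n j))\<bar>" by simp
  also have "\<dots> \<le> cmod (z - of_real (d_pt n j))" by (rule abs_Im_le_cmod)
  also have "\<dots> \<le> cmod (z - p_pt \<gamma> n j) + cmod (p_pt \<gamma> n j - of_real (d_pt n j))"
    using norm_triangle_ineq[of "z - p_pt \<gamma> n j" "p_pt \<gamma> n j - of_real (d_pt n j)"] by simp
  also have "\<dots> \<le> R + 4 * sqrt g / r * (1 / N)"
    using assms cmod_p_pt_minus_d_pt[OF assms(1)] by (simp add: dist_norm norm_minus_commute)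
  also have "\<dots> \<le> sqrt g * r / 4 + 4 * sqrt g / r * (r\<^sup>2 / 16)"
    using R_le inverse_N_le less1 by (intro add_mono mult_left_mono) auto
  also have "\<dots> = sqrt g * (r / 2)" using less1 by (simp add: power2_eq_square)
  also have "\<dots> \<le> 1 * (r / 2)" using s less1 by (intro mult_right_mono) auto
  also have "\<dots> \<le> - ln g / 2" using ln_le_minus_one[OF pos] by simp
  finally show ?thesis by (simp add: inner_strip_def)
qed

text \<open>
  As \<open>p_pt \<gamma> n j\<close> is the image of \<open>d_pt n j\<close>, its distance from \<open>F j z\<close> is at most \<open>c\<close> times the
  distance of \<open>z\<close> from \<open>d_pt n j\<close>, where \<open>c\<close> is of order \<open>1 / N\<close>. The latter distance is at most
  \<open>R\<close> plus a term of order \<open>1 / N\<close>; after multiplication by \<open>c\<close> each contribution is at most \<open>R / 8\<close>.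
  That the image lies in the open disc matters because \<open>B_disk\<close> is open, whereas Banach's theorem
  needs a closed one.
\<close>

lemma F_maps_disc_into_ball:
  assumes j: "j \<le> n + 1" and z: "z \<in> cball (p_pt \<gamma> n j) R"
  shows "F j z \<in> ball (p_pt \<gamma> n j) R"
proof -
  let ?d = "of_real (d_pt n j) :: complex" and ?p = "p_pt \<gamma> n j"
  have p: "?p = F j ?d" by (simp add: p_pt_def F_def)
  define c where "c = 2 * sqrt g / (r * N)"
  have c: "0 \<le> c" "c \<le> 1 / 8"
    using less1 contraction_factor_le by (auto simp: c_def)
  have "cmod (F j z - ?p) \<le> c * cmod (z - ?d)"
    unfolding p using F_lipschitz[OF disc_subset_strip[OF j z] of_real_inner_strip[OF less1], of j j]
    by (simp add: c_def)
  also have "\<dots> \<le> c * (R + 4 * sqrt g / r / N)"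
  proof (rule mult_left_mono[OF _ c(1)])
    have "cmod (z - ?d) \<le> cmod (z - ?p) + cmod (?p - ?d)"
      using norm_triangle_ineq[of "z - ?p" "?p - ?d"] by simp
    then show "cmod (z - ?d) \<le> R + 4 * sqrt g / r / N"
      using z cmod_p_pt_minus_d_pt[OF j] by (simp add: dist_norm norm_minus_commute)
  qed
  also have "\<dots> = c * R + c * (4 * sqrt g / r / N)" by (rule distrib_left)
  also have "\<dots> \<le> R / 8 + R / 8"
  proof (rule add_mono)
    show "c * R \<le> R / 8" using mult_right_mono[OF c(2), of R] R_pos by simp
    have "sqrt g * r \<le> 1" using less1 by (intro mult_le_one) auto
    have "c * (4 * sqrt g / r / N) = (sqrt g * r) * (R / 8)"
    proof -
      have "2 * q / (x * y) * (4 * q / x / y) = q * x * (64 * q / x ^ 3 / y\<^sup>2 / 8)"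
        if "0 < x" "0 < y" for q x y :: real
        using that by (simp add: field_simps eval_nat_numeral)
      from this[of r N "sqrt g"] show ?thesis using less1 by (simp only: c_def M_bound_def)
    qed
    also have "\<dots> \<le> 1 * (R / 8)"
      using \<open>sqrt g * r \<le> 1\<close> R_pos by (intro mult_right_mono) auto
    finally show "c * (4 * sqrt g / r / N) \<le> R / 8" by simp
  qed
  finally have "cmod (F j z - ?p) < R" using R_pos by simp
  then show ?thesis by (simp add: dist_norm norm_minus_commute)
qed

lemma s_pt_fixed_point:
  assumes j: "j \<le> n + 1"
  shows "s_pt \<gamma> n j \<in> inner_strip \<gamma>" "s_pt \<gamma> n j = F j (s_pt \<gamma> n j)"
proof -
  let ?C = "cball (p_pt \<gamma> n j) R"
  have "\<exists>!z. z \<in> ?C \<and> F j z = z"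
  proof (rule Banach_fix[where c = "1/8"])
    show "F j ` ?C \<subseteq> ?C" using F_maps_disc_into_ball[OF j] ball_subset_cball by blast
    show "dist (F j w) (F j z) \<le> 1 / 8 * dist w z" if "w \<in> ?C" "z \<in> ?C" for w z
      using F_contraction[OF disc_subset_strip[OF j] disc_subset_strip[OF j], OF that, of j j]
      by (simp add: dist_norm)
  qed (use R_pos in \<open>auto simp: complete_eq_closed\<close>)
  moreover have "B_disk \<gamma> n j = ball (p_pt \<gamma> n j) R"
    by (auto simp: B_disk_def dist_norm norm_minus_commute)
  ultimately have "\<exists>!z. z \<in> B_disk \<gamma> n j \<and> z = F j z"
    using F_maps_disc_into_ball[OF j] by (metis ball_subset_cball subsetD)
  from theI'[OF this] have s: "s_pt \<gamma> n j \<in> B_disk \<gamma> n j \<and> s_pt \<gamma> n j = F j (s_pt \<gamma> n j)"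
    unfolding s_pt_def F_def .
  then show "s_pt \<gamma> n j = F j (s_pt \<gamma> n j)" by blast
  show "s_pt \<gamma> n j \<in> inner_strip \<gamma>"
    using s disc_subset_strip[OF j] by (auto simp: B_disk_def dist_norm norm_minus_commute)
qed

text \<open>
  With \<open>D = d_pt n k - d_pt n j\<close>, the difference \<open>z - w\<close> is within \<open>cmod (z - w) / 8\<close> of \<open>D > 0\<close>. Then
  \<open>cmod (z - w) \<le> 8 / 7 * D\<close>, so the error is at most \<open>D / 7\<close> and the real part remains positive.
\<close>

lemma Re_fixed_point_less:
  assumes "w \<in> inner_strip \<gamma>" "w = F j w" and "z \<in> inner_strip \<gamma>" "z = F k z" and "j < k"
  shows "Re w < Re z"
proof -
  define D where "D = d_pt n k - d_pt n j"
  have D: "0 < D" using \<open>j < k\<close> by (simp add: D_def d_pt_def divide_strict_right_mono)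
  have a: "cmod (z - w - of_real D) \<le> cmod (z - w) / 8"
    using F_contraction[OF assms(3,1), of k j] assms(2,4) by (simp add: D_def)
  have "cmod (z - w) \<le> cmod (z - w - of_real D) + D"
    using norm_triangle_ineq[of "z - w - of_real D" "of_real D"] D by simp
  moreover have "\<bar>Re (z - w - of_real D)\<bar> \<le> cmod (z - w - of_real D)" by (rule abs_Re_le_cmod)
  then have "D - (Re z - Re w) \<le> cmod (z - w - of_real D)" by simp
  ultimately show ?thesis using a D by linarith
qed

lemma zero_fixed_point: "0 = F 0 0"
  by (simp add: F_def d_pt_def theta_0)

lemma pi_fixed_point: "of_real pi = F (n + 1) (of_real pi)"
  by (simp add: F_def d_pt_def theta_pi add.commute)

lemma Re_s_pt_range:
  assumes "1 \<le> j" "j \<le> n"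
  shows "0 < Re (s_pt \<gamma> n j)" "Re (s_pt \<gamma> n j) < pi"
proof -
  show "0 < Re (s_pt \<gamma> n j)"
    using Re_fixed_point_less[OF _ zero_fixed_point s_pt_fixed_point, of j] assms
      of_real_inner_strip[OF less1, of 0] by simp
  show "Re (s_pt \<gamma> n j) < pi"
    using Re_fixed_point_less[OF s_pt_fixed_point _ pi_fixed_point, of j] assms
      of_real_inner_strip[OF less1, of pi] by simp
qed

lemma eigenvalue_fixed_point:
  assumes j: "1 \<le> j" "j \<le> n"
  shows "eigenvalue (A_mat \<gamma> n) (\<psi> (s_pt \<gamma> n j))"
proof -
  let ?s = "s_pt \<gamma> n j"
  have strip: "?s \<in> inner_strip \<gamma>" and fix_pt: "?s = F j ?s"
    using s_pt_fixed_point[of j] j by auto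
  have "(of_nat n + 1) * ?s = (of_nat n + 1) * F j ?s" using fix_pt by simp
  also have "\<dots> = of_nat j * of_real pi + \<theta> \<gamma> ?s"
  proof -
    have "of_nat n + 1 \<noteq> (0 :: complex)" by (metis of_nat_neq_0 of_nat_Suc add.commute)
    then show ?thesis by (simp add: F_def d_pt_def distrib_left)
  qed
  finally have eq: "(of_nat n + 1) * ?s = of_nat j * of_real pi + \<theta> \<gamma> ?s" .
  have "exp (2 * \<i> * ((of_nat n + 1) * ?s)) = exp (2 * \<i> * \<theta> \<gamma> ?s)"
  proof -
    have "2 * \<i> * ((of_nat n + 1) * ?s) = 2 * \<i> * \<theta> \<gamma> ?s + 2 * of_nat j * of_real pi * \<i>"
      unfolding eq by (simp add: algebra_simps)
    then show ?thesis
      using exp_integer_2pi[of "real j"] by (simp add: exp_add mult_ac)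
  qed
  then have "exp (2 * \<i> * ((of_nat n + 1) * ?s)) * (1 + \<i> * \<gamma> * exp (- \<i> * ?s)) = 1 + \<i> * \<gamma> * exp (\<i> * ?s)"
    using exp_theta[OF strip] by simp
  then show ?thesis
    using eigenvalue_A_mat sine_condition sin_nonzero_on_strip Re_s_pt_range[OF j] j by simp
qed

end

section \<open>Eigenvalues and ordering\<close>

theorem corollary3:
  fixes \<gamma> :: complex and n :: nat
  assumes "0 < cmod \<gamma>" and "cmod \<gamma> < 1"
    and "real n \<ge> N_bound \<gamma>"
  shows "(\<forall>j\<in>{1..n}. eigenvalue (A_mat \<gamma> n) (\<psi> (s_pt \<gamma> n j)))
    \<and> inj_on (\<lambda>j. \<psi> (s_pt \<gamma> n j)) {1..n}
    \<and> (\<forall>j\<in>{1..n}. 0 < Re (s_pt \<gamma> n j) \<and> Re (s_pt \<gamma> n j) < pi)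
    \<and> strict_mono_on {1..n} (\<lambda>j. Re (s_pt \<gamma> n j))"
proof -
  interpret gamma_size \<gamma> n using assms by unfold_locales
  have mono: "strict_mono_on {1..n} (\<lambda>j. Re (s_pt \<gamma> n j))"
    by (rule strict_mono_onI) (auto intro!: Re_fixed_point_less s_pt_fixed_point)
  have "inj_on (\<lambda>j. \<psi> (s_pt \<gamma> n j)) {1..n}"
  proof (rule inj_onI)
    fix j k assume jk: "j \<in> {1..n}" "k \<in> {1..n}" "\<psi> (s_pt \<gamma> n j) = \<psi> (s_pt \<gamma> n k)"
    have "s_pt \<gamma> n j = s_pt \<gamma> n k"
      by (rule cos_eq_on_strip) (use jk in \<open>simp_all add: \<psi>_def Re_s_pt_range\<close>)
    then show "j = k"
      by (intro inj_onD[OF strict_mono_on_imp_inj_on[OF mono] _ jk(1,2)]) simp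
  qed
  with mono show ?thesis
    by (simp add: eigenvalue_fixed_point Re_s_pt_range)
qed

end
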